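(* The following $22$ quadruples are the only possible types of series-parallel LCR systems (i.e. the set of types of LCR systems consists exactly of these quadruples): $(1,0,0,0)$, $(-1,0,0,0)$, $(0,0,1,1)$, $(1,-1,1,0)$, $(0,1,0,1)$, $(0,-1,0,0)$, $(1,1,0,0)$, $(-1,1,1,1)$, $(1,1,1,1)$, $(0,0,0,1)$, $(0,0,1,0)$, $(-1,-1,0,0)$, $(1,-1,0,0)$, $(0,1,0,0)$, $(-1,1,0,1)$, $(0,-1,1,0)$, $(0,0,0,0)$, $(-1,-1,1,1)$, $(1,-1,1,1)$, $(1,0,1,0)$, $(-1,0,0,1)$, $(-1,1,0,0)$.
   Context: A series-parallel LCR system is built from base elements (resistors, inductors, capacitors) by finitely many series combinations ($\wedge$) and parallel combinations ($\vee$). Each base element carries its own independent positive parameter: a resistance $R$, an inductance $L$, or an inverse capacitance $C$. The constitutive equation of a system is a linear differential equation $f_1V=f_2I$ relating the voltage $V$ and the current $I$, where $f_1,f_2$ are polynomials in $x=\frac{d}{dt}$ whose coefficients are polynomials in the parameters. It is obtained recursively (without cancelling common factors). A resistor has $V=RI$, an inductor has $V=L\dot I$, a capacitor has $\dot V=CI$. If $N_1,N_2$ have constitutive equations $f_1V=f_2I$ and $f_3V=f_4I$, then $N_1\wedge N_2$ has constitutive equation $f_1f_3V=(f_1f_4+f_2f_3)I$ and $N_1\vee N_2$ has constitutive equation $(f_1f_4+f_2f_3)V=f_2f_4I$. A polynomial alternates if all its odd degree coefficients are zero or all its even degree coefficients are zero. If the constitutive equation is $f_1V=f_2I$ with $f_1=a_{n_1}x^{n_1}+\cdots+a_{m_1}x^{m_1}$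 and $f_2=b_{n_2}x^{n_2}+\cdots+b_{m_2}x^{m_2}$ (where $n_i$ and $m_i$ are the largest and smallest orders occurring with nonzero coefficient), the type of the system is the quadruple $(m_1-m_2,\ n_1-n_2,\ c,\ d)$, where $c=1$ if $f_1$ alternates and $c=0$ otherwise, and $d=1$ if $f_2$ alternates and $d=0$ otherwise. *)

theory Defs
  imports "HOL-Library.Poly_Mapping" "HOL-Computational_Algebra.Polynomial"
begin

(* Series-parallel LCR systems. Every base element carries the name of its parameter:
   resistance, inductance and inverse capacitance, respectively. *)
datatype 'p lcr =
    Resistor 'p
  | Inductor 'p
  | Capacitor 'p
  | Series "'p lcr" "'p lcr"
  | Parallel "'p lcr" "'p lcr"

fun params :: "'p lcr \<Rightarrow> 'p list" where
  "params (Resistor p) = [p]"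
| "params (Inductor p) = [p]"
| "params (Capacitor p) = [p]"
| "params (Series N1 N2) = params N1 @ params N2"
| "params (Parallel N1 N2) = params N1 @ params N2"

(* Each base element has its own parameter. *)
definition independent_params :: "'p lcr \<Rightarrow> bool" where
  "independent_params N \<longleftrightarrow> distinct (params N)"

(* The pair (f1, f2) stands for the constitutive equation f1 V = f2 I, where the polynomial
   variable is the differentiation operator x = d/dt and v interprets the parameters.
   Common factors are not cancelled. *)
fun constitutive :: "('p \<Rightarrow> 'a::comm_semiring_1) \<Rightarrow> 'p lcr \<Rightarrow> 'a poly \<times> 'a poly" where
  "constitutive v (Resistor p) = (1, [:v p:])"
| "constitutive v (Inductor p) = (1, [:0, v p:])"
| "constitutive v (Capacitor p) = ([:0, 1:], [:v p:])"
| "constitutive v (Series N1 N2) =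
    (let (f1, f2) = constitutive v N1; (f3, f4) = constitutive v N2
     in (f1 * f3, f1 * f4 + f2 * f3))"
| "constitutive v (Parallel N1 N2) =
    (let (f1, f2) = constitutive v N1; (f3, f4) = constitutive v N2
     in (f1 * f4 + f2 * f3, f2 * f4))"

definition alternates :: "'a::zero poly \<Rightarrow> bool" where
  "alternates f \<longleftrightarrow> (\<forall>k. odd k \<longrightarrow> coeff f k = 0) \<or> (\<forall>k. even k \<longrightarrow> coeff f k = 0)"

(* Smallest order with nonzero coefficient; only meaningful for f \<noteq> 0. *)
definition low_degree :: "'a::zero poly \<Rightarrow> nat" where
  "low_degree f = (LEAST k. coeff f k \<noteq> 0)"

definition eqn_type :: "'a::zero poly \<times> 'a poly \<Rightarrow> int \<times> int \<times> int \<times> int" where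
  "eqn_type = (\<lambda>(f1, f2).
     (int (low_degree f1) - int (low_degree f2),
      int (degree f1) - int (degree f2),
      of_bool (alternates f1),
      of_bool (alternates f2)))"

(* Multivariate real polynomials in the parameters, as finitely supported functions
   on exponent vectors. *)
type_synonym 'p param_poly = "('p \<Rightarrow>\<^sub>0 nat) \<Rightarrow>\<^sub>0 real"

definition param_var :: "'p \<Rightarrow> 'p param_poly" where
  "param_var p = Poly_Mapping.single (Poly_Mapping.single p 1) 1"

(* The parameters are indeterminates here, so "nonzero coefficient" means nonzero as a polynomial
   in the parameters. By lcr_type_positive_values below, substituting arbitrary positive real
   values for the parameters gives the same type. *)
definition lcr_type :: "'p lcr \<Rightarrow> int \<times> int \<times> int \<times> int" where
  "lcr_type N = eqn_type (constitutive param_var N)"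


definition positive_cone :: "'a::comm_semiring_1 set \<Rightarrow> bool" where
  "positive_cone P \<longleftrightarrow> 0 \<in> P \<and> 1 \<in> P \<and>
     (\<forall>a\<in>P. \<forall>b\<in>P. a + b \<in> P \<and> a * b \<in> P \<and>
        (a + b = 0 \<longrightarrow> a = 0 \<and> b = 0) \<and> (a * b = 0 \<longrightarrow> a = 0 \<or> b = 0))"

definition coeffs_in :: "'a::zero set \<Rightarrow> 'a poly \<Rightarrow> bool" where
  "coeffs_in P f \<longleftrightarrow> (\<forall>k. coeff f k \<in> P)"

definition supp :: "'a::zero poly \<Rightarrow> nat set" where
  "supp f = {k. coeff f k \<noteq> 0}"

lemma cone_sum:
  assumes "positive_cone P" "finite A" "\<And>i. i \<in> A \<Longrightarrow> h i \<in> P"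
  shows "sum h A \<in> P \<and> (sum h A = 0 \<longleftrightarrow> (\<forall>i\<in>A. h i = 0))"
  using assms(2,3)
proof (induction A rule: finite_induct)
  case empty
  then show ?case using assms(1) by (simp add: positive_cone_def)
next
  case (insert x A)
  then have "h x \<in> P" "sum h A \<in> P" "sum h A = 0 \<longleftrightarrow> (\<forall>i\<in>A. h i = 0)" by auto
  with assms(1) insert.hyps show ?case
    unfolding positive_cone_def by (metis add_0 insert_iff sum.insert)
qed

lemma cone_mult_iff:
  assumes "positive_cone P" "a \<in> P" "b \<in> P"
  shows "a * b \<noteq> 0 \<longleftrightarrow> a \<noteq> 0 \<and> b \<noteq> 0"
  using assms unfolding positive_cone_def by (metis mult_zero_left mult_zero_right)

lemma coeffs_in_add:
  assumes "positive_cone P" "coeffs_in P f" "coeffs_in P g"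
  shows "coeffs_in P (f + g)" "supp (f + g) = supp f \<union> supp g"
proof -
  have "coeff f k + coeff g k \<in> P \<and>
      (coeff f k + coeff g k = 0 \<longleftrightarrow> coeff f k = 0 \<and> coeff g k = 0)" for k
    using assms unfolding positive_cone_def coeffs_in_def by (metis add_0)
  then show "coeffs_in P (f + g)" "supp (f + g) = supp f \<union> supp g"
    by (auto simp: coeffs_in_def supp_def)
qed

lemma coeffs_in_mult:
  assumes "positive_cone P" "coeffs_in P f" "coeffs_in P g"
  shows "coeffs_in P (f * g)" "supp (f * g) = {i + j | i j. i \<in> supp f \<and> j \<in> supp g}"
proof -
  have m: "coeff f i * coeff g j \<in> P" for i j
    using assms by (auto simp: positive_cone_def coeffs_in_def)
  have z: "coeff f i * coeff g j \<noteq> 0 \<longleftrightarrow> coeff f i \<noteq> 0 \<and> coeff g j \<noteq> 0" for i j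
    using assms by (intro cone_mult_iff) (auto simp: coeffs_in_def)
  have s: "coeff (f * g) k \<in> P \<and>
      (coeff (f * g) k = 0 \<longleftrightarrow> (\<forall>i\<in>{..k}. coeff f i * coeff g (k - i) = 0))" for k
    unfolding coeff_mult by (rule cone_sum[OF assms(1)]) (auto simp: m)
  show "coeffs_in P (f * g)" using s by (simp add: coeffs_in_def)
  have "coeff (f * g) k \<noteq> 0 \<longleftrightarrow> (\<exists>i j. k = i + j \<and> coeff f i \<noteq> 0 \<and> coeff g j \<noteq> 0)" for k
  proof -
    have "coeff (f * g) k \<noteq> 0 \<longleftrightarrow> (\<exists>i\<le>k. coeff f i \<noteq> 0 \<and> coeff g (k - i) \<noteq> 0)"
      using s[of k] z by auto
    also have "\<dots> \<longleftrightarrow> (\<exists>i j. k = i + j \<and> coeff f i \<noteq> 0 \<and> coeff g j \<noteq> 0)"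
      by (metis diff_add_inverse le_add1 le_add_diff_inverse)
    finally show ?thesis .
  qed
  then show "supp (f * g) = {i + j | i j. i \<in> supp f \<and> j \<in> supp g}"
    by (auto simp: supp_def)
qed

lemma coeffs_in_base:
  assumes "positive_cone P" "a \<in> P"
  shows "coeffs_in P 1" "coeffs_in P [:a:]" "coeffs_in P [:0, a:]"
  using assms by (auto simp: coeffs_in_def positive_cone_def coeff_pCons split: nat.split)

lemma supp_one: "supp (1 :: 'a::comm_semiring_1 poly) = {0}"
  by (auto simp: supp_def)

lemma supp_base:
  fixes a :: "'a::comm_semiring_1"
  assumes "a \<noteq> 0"
  shows "supp [:a:] = {0}" "supp [:0, a:] = {1}"
proof -
  have "coeff [:a:] k \<noteq> 0 \<longleftrightarrow> k = 0" for k
    using assms by (cases k) auto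
  then show "supp [:a:] = {0}"
    by (auto simp: supp_def)
  have "coeff [:0, a:] k \<noteq> 0 \<longleftrightarrow> k = 1" for k
    using assms by (cases k; cases "k - 1") auto
  then show "supp [:0, a:] = {1}" by (auto simp: supp_def)
qed

lemma constitutive_supp:
  fixes v :: "'p \<Rightarrow> 'a::comm_semiring_1" and w :: "'p \<Rightarrow> 'b::comm_semiring_1"
  assumes P: "positive_cone P" "\<And>p. v p \<in> P \<and> v p \<noteq> 0"
    and Q: "positive_cone Q" "\<And>p. w p \<in> Q \<and> w p \<noteq> 0"
  shows "coeffs_in P (fst (constitutive v N)) \<and> coeffs_in P (snd (constitutive v N)) \<and>
         coeffs_in Q (fst (constitutive w N)) \<and> coeffs_in Q (snd (constitutive w N)) \<and>
         supp (fst (constitutive v N)) = supp (fst (constitutive w N)) \<and>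
         supp (snd (constitutive v N)) = supp (snd (constitutive w N))"
proof -
  have one: "1 \<in> P" "1 \<in> Q" using P(1) Q(1) by (auto simp: positive_cone_def)
  show ?thesis
  proof (induction N)
    case (Series N1 N2)
    then show ?case
      by (auto simp: split_def Let_def coeffs_in_add[OF P(1)] coeffs_in_add[OF Q(1)]
          coeffs_in_mult[OF P(1)] coeffs_in_mult[OF Q(1)])
  next
    case (Parallel N1 N2)
    then show ?case
      by (auto simp: split_def Let_def coeffs_in_add[OF P(1)] coeffs_in_add[OF Q(1)]
          coeffs_in_mult[OF P(1)] coeffs_in_mult[OF Q(1)])
  qed (use P Q one in \<open>simp_all add: coeffs_in_base supp_base supp_one\<close>)
qed

lemma eqn_type_cong_supp:
  assumes "supp f1 = supp g1" "supp f2 = supp g2"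
  shows "eqn_type (f1, f2) = eqn_type (g1, g2)"
proof -
  have "coeff f1 k = 0 \<longleftrightarrow> coeff g1 k = 0" "coeff f2 k = 0 \<longleftrightarrow> coeff g2 k = 0" for k
    using assms by (auto simp: supp_def set_eq_iff)
  then show ?thesis
    by (simp add: eqn_type_def low_degree_def alternates_def degree_def)
qed

lemma positive_cone_real: "positive_cone {a::real. 0 \<le> a}"
  by (auto simp: positive_cone_def)

lemma positive_cone_param_poly:
  "positive_cone {f :: nat param_poly. \<forall>m. 0 \<le> Poly_Mapping.lookup f m}"
proof -
  have mult: "0 \<le> Poly_Mapping.lookup (f * g) m"
    if "\<forall>m. 0 \<le> Poly_Mapping.lookup f m" "\<forall>m. 0 \<le> Poly_Mapping.lookup g m" for f g :: "nat param_poly" and m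
  proof -
    have "0 \<le> Poly_Mapping.lookup f l * (\<Sum>q. Poly_Mapping.lookup g q when m = l + q)" for l
      using that by (intro mult_nonneg_nonneg)
        (auto simp: Sum_any.expand_set when_def intro!: sum_nonneg)
    then show ?thesis
      unfolding lookup_mult by (subst Sum_any.expand_set) (rule sum_nonneg, blast)
  qed
  have add: "f = 0 \<and> g = 0"
    if "\<forall>m. 0 \<le> Poly_Mapping.lookup f m" "\<forall>m. 0 \<le> Poly_Mapping.lookup g m" "f + g = 0" for f g :: "nat param_poly"
  proof -
    have "Poly_Mapping.lookup f m + Poly_Mapping.lookup g m = 0" for m
      using that(3) by (metis lookup_add lookup_zero)
    then have "Poly_Mapping.lookup f m = 0 \<and> Poly_Mapping.lookup g m = 0" for m
      using that(1,2) by (metis add_nonneg_eq_0_iff)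
    then show ?thesis by (simp add: poly_mapping_eq_iff fun_eq_iff)
  qed
  show ?thesis
    unfolding positive_cone_def
  proof (intro conjI ballI)
    fix f g :: "nat param_poly"
    assume "f \<in> {f. \<forall>m. 0 \<le> Poly_Mapping.lookup f m}" "g \<in> {f. \<forall>m. 0 \<le> Poly_Mapping.lookup f m}"
    then have fg: "\<forall>m. 0 \<le> Poly_Mapping.lookup f m" "\<forall>m. 0 \<le> Poly_Mapping.lookup g m" by simp_all
    show "f + g \<in> {f. \<forall>m. 0 \<le> Poly_Mapping.lookup f m}" using fg by (simp add: lookup_add)
    show "f * g \<in> {f. \<forall>m. 0 \<le> Poly_Mapping.lookup f m}" using mult[OF fg] by simp
    show "f + g = 0 \<longrightarrow> f = 0 \<and> g = 0" using add[OF fg] by blast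
    show "f * g = 0 \<longrightarrow> f = 0 \<or> g = 0" by simp
  qed (simp_all add: lookup_one when_def)
qed

lemma lcr_type_positive_values:
  fixes v :: "nat \<Rightarrow> real"
  assumes "\<And>p. 0 < v p"
  shows "eqn_type (constitutive v N) = lcr_type N"
proof -
  have v: "v p \<in> {a. 0 \<le> a} \<and> v p \<noteq> 0" for p
    using assms[of p] by simp
  have "param_var p \<noteq> 0" for p :: nat
    unfolding param_var_def by (metis lookup_single_eq lookup_zero zero_neq_one)
  then have w: "param_var p \<in> {f. \<forall>m. 0 \<le> Poly_Mapping.lookup f m} \<and> param_var p \<noteq> 0" for p :: nat
    by (simp add: param_var_def lookup_single when_def)
  obtain f1 f2 g1 g2 where fg: "constitutive v N = (f1, f2)" "constitutive param_var N = (g1, g2)"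
    by (metis prod.exhaust)
  show ?thesis
    unfolding lcr_type_def fg
    using constitutive_supp[where N = N and v = v and w = param_var,
        OF positive_cone_real v positive_cone_param_poly w]
    by (intro eqn_type_cong_supp) (simp_all add: fg)
qed

end

theory Submission
  imports Defs
begin

text \<open>
  Parameters are positive, so no coefficient ever cancels, and only the exponents that occur in the
  polynomials matter. Evaluating every parameter at \<open>1\<close> therefore keeps the type
  and puts all work into real polynomials with nonnegative coefficients. For those, exponents of
  products and sums are Minkowski sums and unions of exponents, so lowest and highest orders and
  alternation can be followed through a series combination. The crucial point is that the type of
  the combination is then a function of the types of its two parts (lemma
  \<open>eqn_type_series\<close>): the order differences combine by maximum and minimum, \<open>f\<^sub>1 f\<^sub>3\<close>
  alternates iff both factors do, and \<open>f\<^sub>1 f\<^sub>4 + f\<^sub>2 f\<^sub>3\<close> alternates iff all four polynomials do and the two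
  summands have the same parity, which is the parity condition on the first entries of the types.
  Exchanging voltage and current turns parallel combinations into series combinations, so they
  need no separate analysis.

  Thus the set of types is the closure of \<open>(0,0,1,1)\<close>, \<open>(-1,-1,1,1)\<close> and \<open>(1,1,1,1)\<close> (resistor,
  inductor, capacitor) under two explicit operations. It is cut out by three conditions on
  \<open>(m,n,c,d)\<close> with \<open>m, n \<in> {-1,0,1}\<close>: if both polynomials alternate then \<open>m\<close> and \<open>n\<close> have equal
  parity; if only the first does then \<open>n \<le> 0 \<le> m\<close>; if only the second does then \<open>m \<le> 0 \<le> n\<close>.
  These conditions survive both operations. Conversely they leave \<open>5 + 4 + 4 + 9\<close> quadruples.
  The types with an alternating polynomial come from small circuits. The other nine follow from one
  observation: the type \<open>(1,-1,1,0)\<close> of a resistor, an inductor and a capacitor in series is neutral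
  for minimum and maximum, so putting that circuit in parallel to another one retains the order
  differences of the latter and destroys both alternations.
\<close>

section \<open>Exponents of polynomials with nonnegative coefficients\<close>

definition nonneg_poly :: "real poly \<Rightarrow> bool" where
  "nonneg_poly f \<longleftrightarrow> coeffs_in {a. 0 \<le> a} f \<and> f \<noteq> 0"

lemma supp_nonempty: "f \<noteq> 0 \<Longrightarrow> supp f \<noteq> {}"
  by (auto simp: supp_def poly_eq_iff)

lemma nonneg_poly_mult:
  assumes "nonneg_poly f" "nonneg_poly g"
  shows "nonneg_poly (f * g)" "supp (f * g) = {i + j | i j. i \<in> supp f \<and> j \<in> supp g}"
  using assms coeffs_in_mult[OF positive_cone_real] by (simp_all add: nonneg_poly_def)

lemma nonneg_poly_add:
  assumes "nonneg_poly f" "nonneg_poly g"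
  shows "nonneg_poly (f + g)" "supp (f + g) = supp f \<union> supp g"
proof -
  have s: "coeffs_in {a. 0 \<le> a} (f + g)" "supp (f + g) = supp f \<union> supp g"
    using assms coeffs_in_add[OF positive_cone_real] by (simp_all add: nonneg_poly_def)
  show "supp (f + g) = supp f \<union> supp g" by (fact s(2))
  have "supp f \<noteq> {}" using assms(1) by (simp add: nonneg_poly_def supp_nonempty)
  then have "supp (f + g) \<noteq> {}" using s(2) by simp
  then have "f + g \<noteq> 0" unfolding supp_def by fastforce
  then show "nonneg_poly (f + g)" using s(1) by (simp add: nonneg_poly_def)
qed

lemma low_degree_in_supp: "f \<noteq> 0 \<Longrightarrow> low_degree f \<in> supp f"
  using supp_nonempty[of f] unfolding supp_def low_degree_def
  by (metis (mono_tags, lifting) Collect_empty_eq LeastI_ex mem_Collect_eq)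

lemma low_degree_le: "i \<in> supp f \<Longrightarrow> low_degree f \<le> i"
  by (auto simp: supp_def low_degree_def intro: Least_le)

lemma low_degree_eqI:
  assumes "k \<in> supp f" "\<And>i. i \<in> supp f \<Longrightarrow> k \<le> i"
  shows "low_degree f = k"
  using assms unfolding supp_def low_degree_def by (intro Least_equality) auto

lemma degree_in_supp: "f \<noteq> 0 \<Longrightarrow> degree f \<in> supp f"
  by (simp add: supp_def)

lemma degree_ge: "i \<in> supp f \<Longrightarrow> i \<le> degree f"
  by (simp add: supp_def le_degree)

lemma degree_eqI:
  assumes "k \<in> supp f" "\<And>i. i \<in> supp f \<Longrightarrow> i \<le> k"
  shows "degree f = k"
proof (rule antisym)
  have "f \<noteq> 0" using assms(1) by (auto simp: supp_def)
  then show "degree f \<le> k" by (intro assms(2) degree_in_supp)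
qed (rule degree_ge[OF assms(1)])

lemma low_degree_mult:
  assumes "nonneg_poly f" "nonneg_poly g"
  shows "low_degree (f * g) = low_degree f + low_degree g"
proof (rule low_degree_eqI)
  show "low_degree f + low_degree g \<in> supp (f * g)"
    using assms low_degree_in_supp by (auto simp: nonneg_poly_mult nonneg_poly_def)
qed (use assms in \<open>auto simp: nonneg_poly_mult intro!: add_mono low_degree_le\<close>)

lemma low_degree_add:
  assumes "nonneg_poly f" "nonneg_poly g"
  shows "low_degree (f + g) = min (low_degree f) (low_degree g)"
proof (rule low_degree_eqI)
  show "min (low_degree f) (low_degree g) \<in> supp (f + g)"
    using assms low_degree_in_supp by (auto simp: nonneg_poly_add nonneg_poly_def min_def)
qed (use assms in \<open>auto simp: nonneg_poly_add min_le_iff_disj dest: low_degree_le\<close>)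

lemma degree_add_nonneg_poly:
  assumes "nonneg_poly f" "nonneg_poly g"
  shows "degree (f + g) = max (degree f) (degree g)"
proof (rule degree_eqI)
  show "max (degree f) (degree g) \<in> supp (f + g)"
    using assms degree_in_supp by (auto simp: nonneg_poly_add nonneg_poly_def max_def)
qed (use assms in \<open>auto simp: nonneg_poly_add le_max_iff_disj dest: degree_ge\<close>)

lemma alternates_iff: "alternates f \<longleftrightarrow> (\<forall>i\<in>supp f. \<forall>j\<in>supp f. even i = even j)"
  unfolding alternates_def supp_def by blast

lemma alternates_mult:
  assumes "nonneg_poly f" "nonneg_poly g"
  shows "alternates (f * g) \<longleftrightarrow> alternates f \<and> alternates g"
proof
  assume fg: "alternates (f * g)"
  \<comment> \<open>Shifting the exponents of one factor by a fixed exponent of the other one lands in the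
    exponents of the product and keeps parity differences.\<close>
  have *: "even (i + j) = even (i' + j')"
    if "i \<in> supp f" "i' \<in> supp f" "j \<in> supp g" "j' \<in> supp g" for i i' j j'
    using fg that unfolding alternates_iff nonneg_poly_mult(2)[OF assms] by blast
  have "low_degree f \<in> supp f" "low_degree g \<in> supp g"
    using assms by (auto simp: nonneg_poly_def low_degree_in_supp)
  then show "alternates f \<and> alternates g"
    unfolding alternates_iff using * by (metis even_add)
next
  assume alt: "alternates f \<and> alternates g"
  have "even (i + j) = even (i' + j')"
    if "i \<in> supp f" "i' \<in> supp f" "j \<in> supp g" "j' \<in> supp g" for i i' j j'
  proof -
    have "even i = even i'" "even j = even j'"
      using alt that unfolding alternates_iff by blast+
    then show ?thesis by simp
  qed
  then show "alternates (f * g)"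
    unfolding alternates_iff nonneg_poly_mult(2)[OF assms] by blast
qed

lemma alternates_add:
  assumes "nonneg_poly f" "nonneg_poly g"
  shows "alternates (f + g) \<longleftrightarrow>
    alternates f \<and> alternates g \<and> even (low_degree f) = even (low_degree g)"
proof -
  have "low_degree f \<in> supp f" "low_degree g \<in> supp g"
    using assms by (auto simp: nonneg_poly_def low_degree_in_supp)
  then show ?thesis
    unfolding alternates_iff nonneg_poly_add(2)[OF assms] by (meson Un_iff)
qed

section \<open>The type of a combination is a function of the types of its parts\<close>

type_synonym quadruple = "int \<times> int \<times> int \<times> int"

fun series_type :: "quadruple \<Rightarrow> quadruple \<Rightarrow> quadruple" where
  "series_type (m, n, c, d) (m', n', c', d') =
     (max m m', min n n', c * c', c * c' * d * d' * of_bool (even (m - m')))"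

text \<open>The effect on types of exchanging voltage and current.\<close>

fun dual_type :: "quadruple \<Rightarrow> quadruple" where
  "dual_type (m, n, c, d) = (- m, - n, d, c)"

definition parallel_type :: "quadruple \<Rightarrow> quadruple \<Rightarrow> quadruple" where
  "parallel_type s t = dual_type (series_type (dual_type s) (dual_type t))"

text \<open>
  Let \<open>m\<^sub>i\<close> be the lowest order of \<open>f\<^sub>i\<close>.
  Subtracting the lowest order \<open>min (m\<^sub>1 + m\<^sub>4) (m\<^sub>2 + m\<^sub>3)\<close> of the new right-hand side from \<open>m\<^sub>1 + m\<^sub>3\<close>
  leaves \<open>max (m\<^sub>3 - m\<^sub>4) (m\<^sub>1 - m\<^sub>2)\<close>, and dually for the highest orders. The same numbers decide
  whether the summands \<open>f\<^sub>1 f\<^sub>4\<close> and \<open>f\<^sub>2 f\<^sub>3\<close> have the same parity.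
\<close>

lemma eqn_type_series:
  assumes f: "nonneg_poly f1" "nonneg_poly f2" "nonneg_poly f3" "nonneg_poly f4"
  shows "eqn_type (f1 * f3, f1 * f4 + f2 * f3) =
    series_type (eqn_type (f1, f2)) (eqn_type (f3, f4))"
proof -
  have nz: "f1 \<noteq> 0" "f2 \<noteq> 0" "f3 \<noteq> 0" "f4 \<noteq> 0"
    using f by (auto simp: nonneg_poly_def)
  note p = nonneg_poly_mult(1)[OF f(1) f(4)] nonneg_poly_mult(1)[OF f(2) f(3)]
  have par: "even (low_degree f1 + low_degree f4) = even (low_degree f2 + low_degree f3) \<longleftrightarrow>
      even (int (low_degree f1) - int (low_degree f2) - (int (low_degree f3) - int (low_degree f4)))"
    by auto
  have "alternates (f1 * f4 + f2 * f3) \<longleftrightarrow>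
      alternates f1 \<and> alternates f3 \<and> alternates f2 \<and> alternates f4 \<and>
      even (int (low_degree f1) - int (low_degree f2) - (int (low_degree f3) - int (low_degree f4)))"
    unfolding alternates_add[OF p] par[symmetric]
    using f by (auto simp: alternates_mult low_degree_mult)
  moreover have "int (low_degree (f1 * f3)) - int (low_degree (f1 * f4 + f2 * f3)) =
      max (int (low_degree f1) - int (low_degree f2)) (int (low_degree f3) - int (low_degree f4))"
    using f by (simp add: low_degree_add[OF p] low_degree_mult)
  moreover have "int (degree (f1 * f3)) - int (degree (f1 * f4 + f2 * f3)) =
      min (int (degree f1) - int (degree f2)) (int (degree f3) - int (degree f4))"
    using nz by (simp add: degree_add_nonneg_poly[OF p] degree_mult_eq)
  ultimately show ?thesis
    using f by (simp add: eqn_type_def alternates_mult of_bool_conj)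
qed

lemma eqn_type_swap: "eqn_type (f2, f1) = dual_type (eqn_type (f1, f2))"
  by (simp add: eqn_type_def)

lemma nonneg_poly_constitutive:
  "nonneg_poly (fst (constitutive (\<lambda>_. 1) N)) \<and> nonneg_poly (snd (constitutive (\<lambda>_. 1) N))"
  by (induction N)
     (auto simp: split_def Let_def nonneg_poly_add nonneg_poly_mult,
      auto simp: nonneg_poly_def coeffs_in_def coeff_pCons split: nat.split)

lemma lcr_type_unit_values:
  "lcr_type N = eqn_type (constitutive (\<lambda>_. 1 :: real) N)" for N :: "nat lcr"
  by (simp add: lcr_type_positive_values)

lemma lcr_type_series:
  "lcr_type (Series N1 N2) = series_type (lcr_type N1) (lcr_type N2)" for N1 N2 :: "nat lcr"
  using nonneg_poly_constitutive[of N1] nonneg_poly_constitutive[of N2] eqn_type_series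
  by (auto simp: lcr_type_unit_values split: prod.split)

lemma lcr_type_parallel:
  "lcr_type (Parallel N1 N2) = parallel_type (lcr_type N1) (lcr_type N2)" for N1 N2 :: "nat lcr"
proof -
  obtain f1 f2 f3 f4 where
    f: "constitutive (\<lambda>_. 1 :: real) N1 = (f1, f2)" "constitutive (\<lambda>_. 1 :: real) N2 = (f3, f4)"
    by (metis prod.exhaust)
  then have "nonneg_poly f1" "nonneg_poly f2" "nonneg_poly f3" "nonneg_poly f4"
    using nonneg_poly_constitutive[of N1] nonneg_poly_constitutive[of N2] by auto
  then have "eqn_type (f2 * f4, f2 * f3 + f1 * f4) =
      series_type (eqn_type (f2, f1)) (eqn_type (f4, f3))"
    by (intro eqn_type_series)
  then have "eqn_type (f1 * f4 + f2 * f3, f2 * f4) =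
      parallel_type (eqn_type (f1, f2)) (eqn_type (f3, f4))"
    unfolding parallel_type_def by (metis add.commute eqn_type_swap)
  then show ?thesis by (simp add: lcr_type_unit_values f)
qed

lemma lcr_type_base:
  fixes p :: nat
  shows "lcr_type (Resistor p) = (0, 0, 1, 1)"
    and "lcr_type (Inductor p) = (-1, -1, 1, 1)"
    and "lcr_type (Capacitor p) = (1, 1, 1, 1)"
proof -
  have supp: "supp [:1 :: real:] = {0}" "supp [:0, 1 :: real:] = {1}"
    using supp_base[of "1 :: real"] by simp_all
  have low: "low_degree [:1 :: real:] = 0" "low_degree [:0, 1 :: real:] = 1"
    by (rule low_degree_eqI; simp add: supp)+
  have alt: "alternates [:1 :: real:]" "alternates [:0, 1 :: real:]"
    by (simp_all add: alternates_iff supp)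
  show "lcr_type (Resistor p) = (0, 0, 1, 1)"
    and "lcr_type (Inductor p) = (-1, -1, 1, 1)"
    and "lcr_type (Capacitor p) = (1, 1, 1, 1)"
    by (simp_all add: lcr_type_unit_values eqn_type_def one_pCons low alt)
qed

section \<open>Constraints on the types\<close>

fun admissible :: "quadruple \<Rightarrow> bool" where
  "admissible (m, n, c, d) \<longleftrightarrow> m \<in> {-1, 0, 1} \<and> n \<in> {-1, 0, 1} \<and>
     (c = 1 \<and> d = 1 \<and> even (m - n) \<or> c = 1 \<and> d = 0 \<and> n \<le> 0 \<and> 0 \<le> m \<or>
      c = 0 \<and> d = 1 \<and> m \<le> 0 \<and> 0 \<le> n \<or> c = 0 \<and> d = 0)"

text \<open>
  The interesting case is that the first polynomial of the combination alternates and the second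
  one does not. Then either some part already has this property, and its inequalities survive
  maximum and minimum, or the second polynomials of both parts alternate and the parities differ.
  In the latter situation the part of even parity has order differences \<open>(0, 0)\<close>, which forces the
  inequalities again.
\<close>

lemma admissible_series:
  assumes "admissible s" "admissible t"
  shows "admissible (series_type s t)"
proof -
  obtain m n c d m' n' c' d' where st: "s = (m, n, c, d)" "t = (m', n', c', d')"
    by (metis prod.exhaust)
  have range: "max m m' \<in> {-1, 0, 1}" "min n n' \<in> {-1, 0, 1}"
    using assms unfolding st admissible.simps by (simp_all add: max_def min_def)
  consider (zero) "c * c' = 0" | (both) "c = 1" "c' = 1" "d = 1" "d' = 1"
    | (left) "c = 1" "c' = 1" "d = 0" | (right) "c = 1" "c' = 1" "d' = 0"
    using assms unfolding st by fastforce
  then show ?thesis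
  proof cases
    case zero
    then show ?thesis using range by (simp add: st)
  next
    case both
    then have par: "even (m - n)" "even (m' - n')" using assms by (simp_all add: st)
    show ?thesis
    proof (cases "even (m - m')")
      case True
      then have "even (max m m' - min n n')" using par by (auto simp: max_def min_def)
      then show ?thesis using both True range by (simp add: st)
    next
      case False
      then consider "even m" "even n" | "even m'" "even n'" using par by auto
      moreover have "k = 0" if "even k" "k \<in> {-1, 0, 1}" for k :: int using that by auto
      moreover have "m \<in> {-1, 0, 1}" "n \<in> {-1, 0, 1}" "m' \<in> {-1, 0, 1}" "n' \<in> {-1, 0, 1}"
        using assms unfolding st admissible.simps by blast+
      ultimately have "m = 0 \<and> n = 0 \<or> m' = 0 \<and> n' = 0" by metis
      then have "min n n' \<le> 0 \<and> 0 \<le> max m m'" by auto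
      then show ?thesis using both False range by (simp add: st)
    qed
  next
    case left
    then have "min n n' \<le> 0 \<and> 0 \<le> max m m'" using assms by (auto simp: st)
    then show ?thesis using left range by (simp add: st)
  next
    case right
    then have "min n n' \<le> 0 \<and> 0 \<le> max m m'" using assms by (auto simp: st)
    then show ?thesis using right range by (simp add: st)
  qed
qed

lemma admissible_dual: "admissible t \<Longrightarrow> admissible (dual_type t)"
  by (cases t) auto

lemma admissible_lcr_type: "admissible (lcr_type N)" for N :: "nat lcr"
  by (induction N)
     (simp_all add: lcr_type_base lcr_type_series lcr_type_parallel parallel_type_def
       admissible_series admissible_dual)

section \<open>Realizing every admissible type\<close>

definition lcr_types :: "quadruple set" where
  "lcr_types = {lcr_type N | N :: nat lcr. independent_params N}"

lemma lcr_type_map: "lcr_type (map_lcr h N) = lcr_type N" for h :: "nat \<Rightarrow> nat"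
  by (induction N) (simp_all add: lcr_type_base lcr_type_series lcr_type_parallel)

lemma params_map: "params (map_lcr h N) = map h (params N)"
  by (induction N) simp_all

text \<open>
  Renaming parameters keeps types. Hence any two circuits may be assumed to have disjoint
  parameters, say even ones and odd ones, before they are combined.
\<close>

lemma lcr_types_disjoint_params:
  assumes "s \<in> lcr_types" "t \<in> lcr_types"
  obtains N1 N2 :: "nat lcr" where "lcr_type N1 = s" "lcr_type N2 = t"
    "distinct (params N1 @ params N2)"
proof -
  obtain N1 N2 :: "nat lcr" where N: "s = lcr_type N1" "t = lcr_type N2"
    "distinct (params N1)" "distinct (params N2)"
    using assms by (auto simp: lcr_types_def independent_params_def)
  let ?M1 = "map_lcr (\<lambda>p. 2 * p) N1" and ?M2 = "map_lcr (\<lambda>p. 2 * p + 1) N2"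
  have "2 * p \<noteq> 2 * q + 1" for p q :: nat by presburger
  then have "distinct (params ?M1 @ params ?M2)"
    using N(3,4) by (auto simp: params_map distinct_map inj_on_def)
  then show thesis using that[of ?M1 ?M2] N(1,2) by (simp add: lcr_type_map)
qed

lemma lcr_types_series:
  assumes "s \<in> lcr_types" "t \<in> lcr_types"
  shows "series_type s t \<in> lcr_types"
proof -
  obtain N1 N2 :: "nat lcr" where "lcr_type N1 = s" "lcr_type N2 = t"
    "distinct (params N1 @ params N2)"
    using assms by (rule lcr_types_disjoint_params)
  then show ?thesis
    unfolding lcr_types_def independent_params_def
    by (auto intro!: exI[of _ "Series N1 N2"] simp: lcr_type_series)
qed

lemma lcr_types_parallel:
  assumes "s \<in> lcr_types" "t \<in> lcr_types"
  shows "parallel_type s t \<in> lcr_types"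
proof -
  obtain N1 N2 :: "nat lcr" where "lcr_type N1 = s" "lcr_type N2 = t"
    "distinct (params N1 @ params N2)"
    using assms by (rule lcr_types_disjoint_params)
  then show ?thesis
    unfolding lcr_types_def independent_params_def
    by (auto intro!: exI[of _ "Parallel N1 N2"] simp: lcr_type_parallel)
qed

lemma base_in_lcr_types:
  "(0, 0, 1, 1) \<in> lcr_types" "(-1, -1, 1, 1) \<in> lcr_types" "(1, 1, 1, 1) \<in> lcr_types"
  unfolding lcr_types_def independent_params_def
  using lcr_type_base[of 0, symmetric] params.simps(1-3)[of "0 :: nat"]
  by (metis (mono_tags, lifting) distinct_singleton mem_Collect_eq)+

lemma admissible_in_lcr_types:
  assumes "admissible t"
  shows "t \<in> lcr_types"
proof -
  note R = base_in_lcr_types(1) and L = base_in_lcr_types(2) and C = base_in_lcr_types(3)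
  have LCs: "(1, -1, 1, 1) \<in> lcr_types" using lcr_types_series[OF L C] by simp
  have LCp: "(-1, 1, 1, 1) \<in> lcr_types"
    using lcr_types_parallel[OF L C] by (simp add: parallel_type_def)
  have first: "(0, 0, 1, 0) \<in> lcr_types" "(0, -1, 1, 0) \<in> lcr_types"
      "(1, 0, 1, 0) \<in> lcr_types" "(1, -1, 1, 0) \<in> lcr_types"
    using lcr_types_series[OF R LCp] lcr_types_series[OF R L] lcr_types_series[OF R C]
      lcr_types_series[OF R LCs] by simp_all
  have second: "(0, 0, 0, 1) \<in> lcr_types" "(0, 1, 0, 1) \<in> lcr_types"
      "(-1, 0, 0, 1) \<in> lcr_types" "(-1, 1, 0, 1) \<in> lcr_types"
    using lcr_types_parallel[OF R LCs] lcr_types_parallel[OF R C] lcr_types_parallel[OF R L]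
      lcr_types_parallel[OF R LCp] by (simp_all add: parallel_type_def)
  \<comment> \<open>Adding a series circuit of a resistor, an inductor and a capacitor in parallel\<close>
  have neither: "(m, n, 0, 0) \<in> lcr_types"
    if "(m, n, c, d) \<in> lcr_types" "m \<le> 1" "-1 \<le> n" for m n c d
    using lcr_types_parallel[OF first(4) that(1)] that(2,3)
    by (simp add: parallel_type_def max_def min_def split: if_splits)
  have none: "(m, n, 0, 0) \<in> lcr_types" if "m \<in> {-1, 0, 1}" "n \<in> {-1, 0, 1}" for m n
    using that R[THEN neither] L[THEN neither] C[THEN neither] LCs[THEN neither]
      LCp[THEN neither] first(2,3)[THEN neither] second(2,3)[THEN neither] by auto
  obtain m n c d where t: "t = (m, n, c, d)" by (metis prod.exhaust)
  consider "c = 1" "d = 1" "even (m - n)" | "c = 1" "d = 0" "n \<le> 0" "0 \<le> m"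
    | "c = 0" "d = 1" "m \<le> 0" "0 \<le> n" | "c = 0" "d = 0"
    using assms unfolding t admissible.simps by blast
  then show ?thesis
  proof cases
    case 1
    then show ?thesis using assms R L C LCs LCp by (auto simp: t)
  next
    case 2
    then show ?thesis using assms first by (auto simp: t)
  next
    case 3
    then show ?thesis using assms second by (auto simp: t)
  next
    case 4
    then show ?thesis using assms none by (simp add: t)
  qed
qed

theorem proposition7p14:
  shows "{lcr_type N | N :: nat lcr. independent_params N} =
    {(1,0,0,0), (-1,0,0,0), (0,0,1,1), (1,-1,1,0), (0,1,0,1), (0,-1,0,0),
     (1,1,0,0), (-1,1,1,1), (1,1,1,1), (0,0,0,1), (0,0,1,0), (-1,-1,0,0),
     (1,-1,0,0), (0,1,0,0), (-1,1,0,1), (0,-1,1,0), (0,0,0,0), (-1,-1,1,1),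
     (1,-1,1,1), (1,0,1,0), (-1,0,0,1), (-1,1,0,0)}" (is "_ = ?T")
proof -
  have "{lcr_type N | N :: nat lcr. independent_params N} = {t. admissible t}"
    using admissible_lcr_type admissible_in_lcr_types unfolding lcr_types_def by blast
  also have "\<dots> = ?T"
  proof
    show "{t. admissible t} \<subseteq> ?T"
    proof
      fix t
      assume "t \<in> {t. admissible t}"
      then show "t \<in> ?T" by (cases t) (simp, elim conjE disjE; simp)
    qed
    show "?T \<subseteq> {t. admissible t}" by simp
  qed
  finally show ?thesis .
qed

end
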